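(* Let $H$ be a finite-dimensional real Hilbert space, let $A = A^* > 0$ be a linear operator on $H$, and let $B = \sum_{\alpha=1}^{p} B_\alpha$, where each $B_\alpha$ is a linear operator on $H$ with $B_\alpha = B_\alpha^* > 0$, $\alpha = 1,2,\dots,p$. Let $\theta, \sigma \in \mathbb{R}$ satisfy $\sigma \ge 1/4$ and $\theta \ge p/2$. Then for every time step $\tau > 0$ the operator $\mathbf{R} = \theta \mathbf{G} - \frac12 \mathbf{C} + \tau(\sigma - \frac14)\mathbf{D}$ satisfies $\mathbf{R} \ge 0$ in $\mathbf{H} = H^p$, and the additive vector scheme $$ B_\alpha \left( \theta \frac{y_\alpha^{n+1} - y_\alpha^{n}}{\tau} + (1-\theta) \frac{y_\alpha^{n} - y_\alpha^{n-1}}{\tau} \right) + \sum_{\beta = 1,\ \beta \ne \alpha}^{p} B_\beta \frac{y_\beta^{n} - y_\beta^{n-1}}{\tau} + A\left(\sigma y_\alpha^{n+1} + (1-2\sigma) y_\alpha^{n} + \sigma y_\alpha^{n-1}\right) = \varphi^n, $$ $$ \alpha = 1,2,\dots,p, \quad n = 1, 2, \dots, $$ is absolutely stable (that is, stable with no restriction on $\tau>0$): for every $\tau > 0$, all right-hand sides $\varphi^n \in H$ and every sequence $\mathbf{y}^n = \{y_1^n, \dots, y_p^n\} \in \mathbf{H}$, $n = 0,1,2,\dots$, satisfying the scheme, the following a priori estimate holds for all $n \ge 1$: $$ \mathcal{E}_{n+1} \le \mathcal{E}_n + \frac{\tau}{2} \left(A^{-1} \varphi^n, \varphi^n\right), $$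 where $$ \mathcal{E}_n = \left\| \frac{\mathbf{y}^{n} + \mathbf{y}^{n-1}}{2} \right\|_{\mathbf{D}}^2 + \frac{1}{\tau} \left( \mathbf{R}(\mathbf{y}^{n} - \mathbf{y}^{n-1}), \mathbf{y}^{n} - \mathbf{y}^{n-1} \right). $$
   Context: $(\cdot,\cdot)$ is the scalar product of $H$; $p \ge 1$ is an integer. The operators $A, B_\alpha$ do not depend on time. For a self-adjoint operator $S$, $S > 0$ means $(Su,u) > 0$ for all $u \ne 0$, and $S \ge 0$ means $(Su,u) \ge 0$ for all $u$. The space $\mathbf{H} = H^p$ consists of vectors $\mathbf{u} = \{u_1, \dots, u_p\}$, $u_\alpha \in H$, with scalar product $(\mathbf{u}, \mathbf{v}) = \sum_{\alpha=1}^p (u_\alpha, v_\alpha)$. The following operator matrices act on $\mathbf{H}$ by $(\mathbf{S}\mathbf{u})_\alpha = \sum_{\beta=1}^p S_{\alpha\beta} u_\beta$: $$ \mathbf{C} = \{C_{\alpha\beta}\},\ C_{\alpha\beta} = B_\alpha A^{-1} B_\beta; \qquad \mathbf{D} = \{D_{\alpha\beta}\},\ D_{\alpha\beta} = B_\alpha \delta_{\alpha\beta}; \qquad \mathbf{G} = \{G_{\alpha\beta}\},\ G_{\alpha\beta} = B_\alpha A^{-1} B_\alpha \delta_{\alpha\beta}, $$ where $\delta_{\alpha\beta}$ is the Kronecker delta. The norm is $\|\mathbf{u}\|_{\mathbf{D}} = (\mathbf{D}\mathbf{u}, \mathbf{u})^{1/2}$. The scheme is a discretization, with time levels $t^n =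 n\tau$, of the system $\sum_{\beta=1}^p B_\beta \frac{du_\beta}{dt} + A u_\alpha = f(t)$, $\alpha = 1,\dots,p$, and $\varphi^n \in H$ is a grid approximation of $f$; the values $\mathbf{y}^0, \mathbf{y}^1$ at the first two time levels are regarded as given. *)

theory Defs
  imports "HOL-Analysis.Analysis"
begin

definition self_adjoint :: "('h::real_inner \<Rightarrow> 'h) \<Rightarrow> bool" where
  "self_adjoint S \<longleftrightarrow> linear S \<and> adjoint S = S"

definition op_pos :: "('h::real_inner \<Rightarrow> 'h) \<Rightarrow> bool" where
  "op_pos S \<longleftrightarrow> self_adjoint S \<and> (\<forall>u. u \<noteq> 0 \<longrightarrow> S u \<bullet> u > 0)"

definition op_nonneg :: "('h::real_inner \<Rightarrow> 'h) \<Rightarrow> bool" where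
  "op_nonneg S \<longleftrightarrow> self_adjoint S \<and> (\<forall>u. S u \<bullet> u \<ge> 0)"

text \<open>
  The product space of p copies of the Hilbert space is the type of vectors over a finite index
  type with p elements; the library inner product of that type is the sum of the componentwise
  ones.
\<close>

definition op_matrix :: "('p \<Rightarrow> 'p \<Rightarrow> 'h \<Rightarrow> 'h) \<Rightarrow> ('h::real_inner)^'p::finite \<Rightarrow> 'h^'p" where
  "op_matrix S u = (\<chi> \<alpha>. \<Sum>\<beta>\<in>UNIV. S \<alpha> \<beta> (u $ \<beta>))"

definition C_op :: "('h \<Rightarrow> 'h) \<Rightarrow> ('p \<Rightarrow> 'h \<Rightarrow> 'h) \<Rightarrow> ('h::real_inner)^'p::finite \<Rightarrow> 'h^'p" where
  "C_op A B = op_matrix (\<lambda>\<alpha> \<beta>. B \<alpha> \<circ> inv A \<circ> B \<beta>)"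

definition D_op :: "('p \<Rightarrow> 'h \<Rightarrow> 'h) \<Rightarrow> ('h::real_inner)^'p::finite \<Rightarrow> 'h^'p" where
  "D_op B = op_matrix (\<lambda>\<alpha> \<beta>. if \<alpha> = \<beta> then B \<alpha> else (\<lambda>_. 0))"

definition G_op :: "('h \<Rightarrow> 'h) \<Rightarrow> ('p \<Rightarrow> 'h \<Rightarrow> 'h) \<Rightarrow> ('h::real_inner)^'p::finite \<Rightarrow> 'h^'p" where
  "G_op A B = op_matrix (\<lambda>\<alpha> \<beta>. if \<alpha> = \<beta> then B \<alpha> \<circ> inv A \<circ> B \<alpha> else (\<lambda>_. 0))"

definition R_op :: "('h \<Rightarrow> 'h) \<Rightarrow> ('p \<Rightarrow> 'h \<Rightarrow> 'h) \<Rightarrow> real \<Rightarrow> real \<Rightarrow> real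
    \<Rightarrow> ('h::real_inner)^'p::finite \<Rightarrow> 'h^'p" where
  "R_op A B \<theta> \<sigma> \<tau> u =
     \<theta> *\<^sub>R G_op A B u - (1/2) *\<^sub>R C_op A B u + (\<tau> * (\<sigma> - 1/4)) *\<^sub>R D_op B u"

definition D_norm :: "('p \<Rightarrow> 'h \<Rightarrow> 'h) \<Rightarrow> ('h::real_inner)^'p::finite \<Rightarrow> real" where
  "D_norm B u = sqrt (D_op B u \<bullet> u)"

definition additive_vector_scheme :: "('h \<Rightarrow> 'h) \<Rightarrow> ('p \<Rightarrow> 'h \<Rightarrow> 'h) \<Rightarrow> real \<Rightarrow> real \<Rightarrow> real
    \<Rightarrow> (nat \<Rightarrow> 'h) \<Rightarrow> (nat \<Rightarrow> ('h::real_inner)^'p::finite) \<Rightarrow> bool" where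
  "additive_vector_scheme A B \<theta> \<sigma> \<tau> \<phi> y \<longleftrightarrow>
    (\<forall>n\<ge>1. \<forall>\<alpha>.
       B \<alpha> (\<theta> *\<^sub>R ((y (n + 1) $ \<alpha> - y n $ \<alpha>) /\<^sub>R \<tau>)
            + (1 - \<theta>) *\<^sub>R ((y n $ \<alpha> - y (n - 1) $ \<alpha>) /\<^sub>R \<tau>))
       + (\<Sum>\<beta>\<in>UNIV - {\<alpha>}. B \<beta> ((y n $ \<beta> - y (n - 1) $ \<beta>) /\<^sub>R \<tau>))
       + A (\<sigma> *\<^sub>R y (n + 1) $ \<alpha> + (1 - 2 * \<sigma>) *\<^sub>R y n $ \<alpha> + \<sigma> *\<^sub>R y (n - 1) $ \<alpha>)
       = \<phi> n)"

text \<open>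
  Meaningful for \<open>n \<ge> 1\<close> only: subtraction on naturals is truncated.
\<close>

definition scheme_energy :: "('h \<Rightarrow> 'h) \<Rightarrow> ('p \<Rightarrow> 'h \<Rightarrow> 'h) \<Rightarrow> real \<Rightarrow> real \<Rightarrow> real
    \<Rightarrow> (nat \<Rightarrow> ('h::real_inner)^'p::finite) \<Rightarrow> nat \<Rightarrow> real" where
  "scheme_energy A B \<theta> \<sigma> \<tau> y n =
     (D_norm B ((y n + y (n - 1)) /\<^sub>R 2))\<^sup>2
     + (1 / \<tau>) * (R_op A B \<theta> \<sigma> \<tau> (y n - y (n - 1)) \<bullet> (y n - y (n - 1)))"

end

theory Submission
  imports Defs
begin

text \<open>
  Applying \<open>B\<^sub>\<alpha> A\<^sup>-\<^sup>1\<close> to the scheme and writing \<open>w\<close>, \<open>z\<close> for the new and the old increment of \<open>y\<close>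
  and \<open>v\<close>, \<open>v'\<close> for the old and the new midpoint, one obtains the canonical form
  \<open>R (w - z) / \<tau> + C (w + z) / (2 \<tau>) + D (v' + v) / 2 = (B\<^sub>\<alpha> A\<^sup>-\<^sup>1 \<phi>)\<^sub>\<alpha>\<close>.
  Its scalar product with \<open>w + z = 2 (v' - v)\<close> telescopes in the terms with \<open>R\<close> and \<open>D\<close>. With
  \<open>s\<close> the sum of the \<open>B\<^sub>\<alpha> (w + z)\<^sub>\<alpha>\<close>, the term with \<open>C\<close> is \<open>(A\<^sup>-\<^sup>1 s, s) / (2 \<tau>)\<close>, which absorbs the
  right-hand side \<open>(A\<^sup>-\<^sup>1 \<phi>, s)\<close> at the price of \<open>\<tau> (A\<^sup>-\<^sup>1 \<phi>, \<phi>) / 2\<close>. Nonnegativity of \<open>R\<close> is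
  \<open>C \<le> p G\<close>, the Cauchy--Schwarz inequality for a sum of \<open>p\<close> terms in the norm of \<open>A\<^sup>-\<^sup>1\<close>.
\<close>

section \<open>Adjoints and inverses of positive operators in finite dimension\<close>

text \<open>
  The library knows that the adjoint exists only on the class \<open>euclidean_space\<close>; otherwise
  \<open>adjoint\<close> is an unspecified choice.
\<close>

lemma adjoint_works_finite_dim:
  fixes f :: "'a::real_inner \<Rightarrow> 'b::real_inner"
  assumes fin_dim: "\<exists>S :: 'a set. finite S \<and> span S = UNIV" and "linear f"
  shows "x \<bullet> adjoint f y = f x \<bullet> y"
proof -
  obtain S :: "'a set" where S: "finite S" "span S = UNIV"
    using fin_dim by blast
  obtain C where C: "finite C" "span C = span S" "pairwise orthogonal C"
    using basis_orthogonal[OF S(1)] by blast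
  \<comment> \<open>The adjoint is written down by Fourier expansion over the orthogonal generating
    set. \<open>C\<close> may contain 0: division by zero makes that coefficient 0, which agrees
    with \<open>f 0 = 0\<close>.\<close>
  define g where "g y = (\<Sum>c\<in>C. ((f c \<bullet> y) / (c \<bullet> c)) *\<^sub>R c)" for y
  have gen: "c \<bullet> g y = f c \<bullet> y" if "c \<in> C" for c y
  proof -
    have "c \<bullet> g y = (\<Sum>d\<in>C. if d = c then f c \<bullet> y else 0)"
      unfolding g_def inner_sum_right
    proof (rule sum.cong)
      fix d assume "d \<in> C"
      then show "c \<bullet> ((f d \<bullet> y) / (d \<bullet> d)) *\<^sub>R d = (if d = c then f c \<bullet> y else 0)"
        using C(3) that linear_0[OF \<open>linear f\<close>]
        by (cases "c = 0") (auto simp: pairwise_def orthogonal_def)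
    qed simp
    then show ?thesis
      using C(1) that by simp
  qed
  have "x \<bullet> g y = f x \<bullet> y" for x y
  proof -
    have "x \<in> span C"
      using C(2) S(2) by simp
    then show ?thesis
      by (induction rule: span_induct_alt)
        (simp_all add: gen inner_add_left linear_0 linear_add linear_scale \<open>linear f\<close>)
  qed
  then have "\<forall>x y. f x \<bullet> y = x \<bullet> g y"
    by simp
  then have "adjoint f = g"
    by (rule adjoint_unique)
  with \<open>\<And>x y. x \<bullet> g y = f x \<bullet> y\<close> show ?thesis
    by simp
qed

lemma self_adjoint_inner:
  fixes S :: "'a::real_inner \<Rightarrow> 'a"
  assumes "\<exists>T :: 'a set. finite T \<and> span T = UNIV" "self_adjoint S"
  shows "S x \<bullet> y = x \<bullet> S y"
  using adjoint_works_finite_dim[OF assms(1), of S x y] assms(2)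
  by (simp add: self_adjoint_def)

lemma self_adjointI:
  assumes "linear S" "\<And>x y. S x \<bullet> y = x \<bullet> S y"
  shows "self_adjoint S"
  using assms by (auto simp: self_adjoint_def intro: adjoint_unique)

text \<open>Positivity forces a trivial kernel, and in finite dimension an injective endomorphism is
  surjective.\<close>

lemma op_pos_bij:
  fixes A :: "'a::real_inner \<Rightarrow> 'a"
  assumes fin_dim: "\<exists>S :: 'a set. finite S \<and> span S = UNIV" and A: "op_pos A"
  shows "bij A"
proof -
  have lin: "linear A" and pos: "\<And>u. u \<noteq> 0 \<Longrightarrow> A u \<bullet> u > 0"
    using A by (auto simp: op_pos_def self_adjoint_def)
  have inj: "inj A"
    unfolding linear_injective_0[OF lin] using pos by (metis inner_zero_left less_irrefl)
  obtain S :: "'a set" where S: "finite S" "span S = UNIV"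
    using fin_dim by blast
  obtain T where T: "T \<subseteq> S" "independent T" "S \<subseteq> span T"
    using maximal_independent_subset[of S] by blast
  have "span T = UNIV"
    using T S by (metis span_mono span_span top.extremum_uniqueI)
  \<comment> \<open>The independent set \<open>T\<close> serves as the finite basis that this locale
    requires, so that its dimension theory applies to \<open>'a\<close>.\<close>
  then interpret finite_dimensional_vector_space "scaleR :: real \<Rightarrow> 'a \<Rightarrow> 'a" T
    using T S by unfold_locales (auto simp: finite_subset dependent_raw_def span_raw_def)
  have "surj A"
    using lin inj by (intro linear_inj_imp_surj) (simp_all add: linear_def)
  with inj show ?thesis
    by (simp add: bij_def)
qed

text \<open>Each property of \<open>A\<close>, evaluated at vectors of the form
  \<open>inv A x\<close>, becomes the same property of \<open>inv A\<close>.\<close>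

lemma op_pos_inv:
  fixes A :: "'a::real_inner \<Rightarrow> 'a"
  assumes fin_dim: "\<exists>S :: 'a set. finite S \<and> span S = UNIV" and A: "op_pos A"
  shows "op_pos (inv A)"
proof -
  have lin: "linear A" and pos: "\<And>u. u \<noteq> 0 \<Longrightarrow> A u \<bullet> u > 0" and sa: "self_adjoint A"
    using A by (auto simp: op_pos_def self_adjoint_def)
  note sym = self_adjoint_inner[OF fin_dim sa]
  have bij: "bij A"
    using assms by (rule op_pos_bij)
  have right: "A (inv A x) = x" for x
    using bij by (simp add: bij_is_surj surj_f_inv_f)
  have left: "inv A (A x) = x" for x
    using bij by (simp add: bij_is_inj)
  have "linear (inv A)"
  proof (rule linearI)
    show "inv A (x + y) = inv A x + inv A y" for x y
      using left[of "inv A x + inv A y"] by (simp add: linear_add[OF lin] right)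
    show "inv A (r *\<^sub>R x) = r *\<^sub>R inv A x" for r x
      using left[of "r *\<^sub>R inv A x"] by (simp add: linear_scale[OF lin] right)
  qed
  moreover have "inv A x \<bullet> y = x \<bullet> inv A y" for x y
    using sym[of "inv A x" "inv A y"] by (simp add: right)
  moreover have "inv A u \<bullet> u > 0" if "u \<noteq> 0" for u
  proof -
    have "inv A u \<noteq> 0"
      using that right[of u] linear_0[OF lin] by force
    from pos[OF this] show ?thesis
      by (simp add: right inner_commute)
  qed
  ultimately show ?thesis
    by (auto simp: op_pos_def intro: self_adjointI)
qed

section \<open>Inequalities for nonnegative quadratic forms\<close>

lemma psd_inner_le:
  fixes S :: "'a::real_inner \<Rightarrow> 'a"
  assumes "linear S" "\<And>x y. S x \<bullet> y = x \<bullet> S y" "\<And>x. S x \<bullet> x \<ge> 0"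
  shows "2 * (S x \<bullet> y) \<le> S x \<bullet> x + S y \<bullet> y"
  using assms(3)[of "x - y"] assms(2)[of x y]
  by (simp add: linear_diff[OF assms(1)] inner_diff_left inner_diff_right inner_commute)

text \<open>In the expanded double sum, each product is at most the mean of its two diagonal values,
  and each diagonal value is then counted \<open>card I\<close> times.\<close>

lemma psd_inner_sum_le:
  fixes S :: "'a::real_inner \<Rightarrow> 'a"
  assumes "linear S" "\<And>x y. S x \<bullet> y = x \<bullet> S y" "\<And>x. S x \<bullet> x \<ge> 0"
  shows "S (\<Sum>i\<in>I. f i) \<bullet> (\<Sum>i\<in>I. f i) \<le> card I * (\<Sum>i\<in>I. S (f i) \<bullet> f i)"
proof -
  have "S (\<Sum>i\<in>I. f i) \<bullet> (\<Sum>i\<in>I. f i) = (\<Sum>i\<in>I. \<Sum>j\<in>I. S (f i) \<bullet> f j)"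
    unfolding linear_sum[OF assms(1)] inner_sum_left by (simp only: inner_sum_right)
  also have "\<dots> \<le> (\<Sum>i\<in>I. \<Sum>j\<in>I. (S (f i) \<bullet> f i + S (f j) \<bullet> f j) / 2)"
    using psd_inner_le[OF assms] by (intro sum_mono) (simp add: field_simps)
  also have "\<dots> = card I * (\<Sum>i\<in>I. S (f i) \<bullet> f i)"
    by (simp add: sum.distrib add_divide_distrib flip: sum_divide_distrib sum_distrib_left)
  finally show ?thesis .
qed

section \<open>The operator matrices on the product space\<close>

lemma C_op_nth:
  assumes "linear (inv A)" "\<And>\<alpha>. linear (B \<alpha>)"
  shows "C_op A B u $ \<alpha> = B \<alpha> (inv A (\<Sum>\<beta>\<in>UNIV. B \<beta> (u $ \<beta>)))"
  by (simp add: C_op_def op_matrix_def linear_sum assms)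

lemma D_op_nth: "D_op B u $ \<alpha> = B \<alpha> (u $ \<alpha>)"
  by (simp add: D_op_def op_matrix_def if_distribR cong: if_cong)

lemma G_op_nth: "G_op A B u $ \<alpha> = B \<alpha> (inv A (B \<alpha> (u $ \<alpha>)))"
  by (simp add: G_op_def op_matrix_def if_distribR cong: if_cong)

text \<open>Symmetry is stated through inner products instead of \<open>adjoint\<close>, so the
  algebra below is separated from the finite-dimensional arguments.\<close>

locale scheme_operators =
  fixes A :: "'h::real_inner \<Rightarrow> 'h" and B :: "'p::finite \<Rightarrow> 'h \<Rightarrow> 'h"
  assumes lin_inv: "linear (inv A)" and lin_B: "linear (B \<alpha>)"
    and inv_sym: "inv A x \<bullet> y = x \<bullet> inv A y" and B_sym: "B \<alpha> x \<bullet> y = x \<bullet> B \<alpha> y"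
    and inv_nonneg: "inv A x \<bullet> x \<ge> 0" and B_nonneg: "B \<alpha> x \<bullet> x \<ge> 0"
begin

lemmas op_nth = C_op_nth[OF lin_inv lin_B] D_op_nth G_op_nth

lemma linear_C_op: "linear (C_op A B)"
  by (rule linearI) (simp_all add: vec_eq_iff op_nth linear_add linear_scale lin_inv lin_B
      sum.distrib flip: scaleR_sum_right)

lemma linear_D_op: "linear (D_op B)"
  by (rule linearI) (simp_all add: vec_eq_iff op_nth linear_add linear_scale lin_B)

lemma linear_G_op: "linear (G_op A B)"
  by (rule linearI) (simp_all add: vec_eq_iff op_nth linear_add linear_scale lin_inv lin_B)

lemma linear_R_op: "linear (R_op A B \<theta> \<sigma> \<tau>)"
  by (rule linearI) (simp_all add: R_op_def linear_add linear_scale linear_C_op linear_D_op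
      linear_G_op algebra_simps)

text \<open>With N u the sum of the \<open>B \<alpha> (u $ \<alpha>)\<close>, the matrix C factors
  as N* A^-1 N, so its form is that of \<open>inv A\<close> pulled back by N.\<close>

lemma C_op_inner:
  "C_op A B u \<bullet> v = inv A (\<Sum>\<alpha>\<in>UNIV. B \<alpha> (u $ \<alpha>)) \<bullet> (\<Sum>\<alpha>\<in>UNIV. B \<alpha> (v $ \<alpha>))"
  by (simp add: inner_vec_def op_nth B_sym inner_sum_right)

lemma C_op_sym: "C_op A B u \<bullet> v = u \<bullet> C_op A B v"
  using inv_sym by (simp add: C_op_inner inner_commute[of u]) (metis inner_commute)

lemma D_op_sym: "D_op B u \<bullet> v = u \<bullet> D_op B v"
  by (simp add: inner_vec_def op_nth B_sym)

lemma G_op_inner: "G_op A B u \<bullet> v = (\<Sum>\<alpha>\<in>UNIV. inv A (B \<alpha> (u $ \<alpha>)) \<bullet> B \<alpha> (v $ \<alpha>))"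
  by (simp add: inner_vec_def op_nth B_sym)

lemma G_op_sym: "G_op A B u \<bullet> v = u \<bullet> G_op A B v"
  by (simp add: inner_vec_def op_nth B_sym inv_sym)

lemma R_op_sym: "R_op A B \<theta> \<sigma> \<tau> u \<bullet> v = u \<bullet> R_op A B \<theta> \<sigma> \<tau> v"
  by (simp add: R_op_def inner_add_left inner_add_right inner_diff_left inner_diff_right
      C_op_sym D_op_sym G_op_sym)

lemma D_op_nonneg: "D_op B u \<bullet> u \<ge> 0"
  by (simp add: inner_vec_def op_nth B_nonneg sum_nonneg)

lemma G_op_nonneg: "G_op A B u \<bullet> u \<ge> 0"
  by (simp add: G_op_inner inv_nonneg sum_nonneg)

lemma C_op_le_G_op: "C_op A B u \<bullet> u \<le> CARD('p) * (G_op A B u \<bullet> u)"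
  unfolding C_op_inner G_op_inner
  by (rule psd_inner_sum_le) (rule lin_inv inv_sym inv_nonneg)+

lemma R_op_nonneg:
  assumes "\<theta> \<ge> CARD('p) / 2" "\<sigma> \<ge> 1/4" "\<tau> > 0"
  shows "op_nonneg (R_op A B \<theta> \<sigma> \<tau>)"
proof -
  have "R_op A B \<theta> \<sigma> \<tau> u \<bullet> u \<ge> 0" for u
  proof -
    \<comment> \<open>Since G is nonnegative, \<theta> may be lowered to p/2, where
      \<open>C_op_le_G_op\<close> already balances the term -C/2.\<close>
    have "\<theta> * (G_op A B u \<bullet> u) \<ge> CARD('p) / 2 * (G_op A B u \<bullet> u)"
      using assms(1) G_op_nonneg by (rule mult_right_mono)
    moreover have "\<tau> * (\<sigma> - 1/4) * (D_op B u \<bullet> u) \<ge> 0"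
      using assms D_op_nonneg by simp
    ultimately show ?thesis
      using C_op_le_G_op[of u] by (simp add: R_op_def inner_add_left inner_diff_left)
  qed
  then show ?thesis
    by (auto simp: op_nonneg_def intro: self_adjointI linear_R_op R_op_sym)
qed

section \<open>Canonical form of the scheme and the energy estimate\<close>

lemma scheme_canonical_form:
  assumes "inj A" "\<tau> \<noteq> 0" "additive_vector_scheme A B \<theta> \<sigma> \<tau> \<phi> y" "n \<ge> 1"
  defines "w \<equiv> y (n + 1) - y n" and "z \<equiv> y n - y (n - 1)"
  shows "(1/\<tau>) *\<^sub>R R_op A B \<theta> \<sigma> \<tau> (w - z) + (1/(2*\<tau>)) *\<^sub>R C_op A B (w + z)
     + D_op B ((1/4) *\<^sub>R (y (n + 1) + 2 *\<^sub>R y n + y (n - 1))) = (\<chi> \<alpha>. B \<alpha> (inv A (\<phi> n)))"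
    (is "?L = _")
proof (rule vec_eq_iff[THEN iffD2], rule allI)
  fix \<alpha>
  define a where "a = y (n + 1)"
  define b where "b = y n"
  define c where "c = y (n - 1)"
  have wz: "w = a - b" "z = b - c"
    by (simp_all add: w_def z_def a_def b_def c_def)
  note lin = linear_add[OF lin_B] linear_diff[OF lin_B] linear_scale[OF lin_B]
    linear_add[OF lin_inv] linear_diff[OF lin_inv] linear_scale[OF lin_inv]
  define s where "s = (\<Sum>\<beta>\<in>UNIV. B \<beta> (z $ \<beta>))"
  define t where "t = (\<Sum>\<beta>\<in>UNIV. B \<beta> (w $ \<beta>))"
  \<comment> \<open>Completing the sum over \<beta> costs one diagonal term, which reduces the
    weights \<theta> w + (1 - \<theta>) z to \<theta> (w - z).\<close>
  have rest: "(\<Sum>\<beta>\<in>UNIV - {\<alpha>}. B \<beta> (z $ \<beta> /\<^sub>R \<tau>)) = s /\<^sub>R \<tau> - B \<alpha> (z $ \<alpha>) /\<^sub>R \<tau>"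
    by (simp add: s_def sum_diff1 lin scaleR_diff_right flip: scaleR_sum_right)
  have "\<phi> n = B \<alpha> (\<theta> *\<^sub>R (w $ \<alpha> /\<^sub>R \<tau>) + (1 - \<theta>) *\<^sub>R (z $ \<alpha> /\<^sub>R \<tau>))
      + (\<Sum>\<beta>\<in>UNIV - {\<alpha>}. B \<beta> (z $ \<beta> /\<^sub>R \<tau>))
      + A (\<sigma> *\<^sub>R a $ \<alpha> + (1 - 2 * \<sigma>) *\<^sub>R b $ \<alpha> + \<sigma> *\<^sub>R c $ \<alpha>)"
    using assms(3,4) by (simp add: additive_vector_scheme_def wz a_def b_def c_def)
  also have "\<dots> = (\<theta> / \<tau>) *\<^sub>R B \<alpha> ((w - z) $ \<alpha>) + (1 / \<tau>) *\<^sub>R s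
      + A (\<sigma> *\<^sub>R a $ \<alpha> + (1 - 2 * \<sigma>) *\<^sub>R b $ \<alpha> + \<sigma> *\<^sub>R c $ \<alpha>)"
    unfolding rest by (simp add: lin algebra_simps divide_inverse)
  finally have "inv A (\<phi> n) = (\<theta> / \<tau>) *\<^sub>R inv A (B \<alpha> ((w - z) $ \<alpha>)) + (1 / \<tau>) *\<^sub>R inv A s
      + (\<sigma> *\<^sub>R a $ \<alpha> + (1 - 2 * \<sigma>) *\<^sub>R b $ \<alpha> + \<sigma> *\<^sub>R c $ \<alpha>)"
    using \<open>inj A\<close> by (simp only: lin inv_f_f)
  then have rhs: "B \<alpha> (inv A (\<phi> n)) = (\<theta> / \<tau>) *\<^sub>R B \<alpha> (inv A (B \<alpha> ((w - z) $ \<alpha>)))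
      + (1 / \<tau>) *\<^sub>R B \<alpha> (inv A s)
      + B \<alpha> (\<sigma> *\<^sub>R a $ \<alpha> + (1 - 2 * \<sigma>) *\<^sub>R b $ \<alpha> + \<sigma> *\<^sub>R c $ \<alpha>)"
    by (simp only: lin)
  have sums: "(\<Sum>\<beta>\<in>UNIV. B \<beta> ((w - z) $ \<beta>)) = t - s" "(\<Sum>\<beta>\<in>UNIV. B \<beta> ((w + z) $ \<beta>)) = t + s"
    by (simp_all add: s_def t_def lin sum.distrib sum_subtractf)
  have "?L $ \<alpha> = (1/\<tau>) *\<^sub>R (\<theta> *\<^sub>R B \<alpha> (inv A (B \<alpha> ((w - z) $ \<alpha>))) - (1/2) *\<^sub>R B \<alpha> (inv A (t - s))
        + (\<tau> * (\<sigma> - 1/4)) *\<^sub>R B \<alpha> ((w - z) $ \<alpha>))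
      + (1/(2*\<tau>)) *\<^sub>R B \<alpha> (inv A (t + s)) + B \<alpha> ((1/4) *\<^sub>R (a $ \<alpha> + 2 *\<^sub>R b $ \<alpha> + c $ \<alpha>))"
  proof -
    have expand: "((1/\<tau>) *\<^sub>R R_op A B \<theta> \<sigma> \<tau> d + (1/(2*\<tau>)) *\<^sub>R C_op A B e + D_op B m) $ \<alpha>
      = (1/\<tau>) *\<^sub>R (\<theta> *\<^sub>R B \<alpha> (inv A (B \<alpha> (d $ \<alpha>)))
          - (1/2) *\<^sub>R B \<alpha> (inv A (\<Sum>\<beta>\<in>UNIV. B \<beta> (d $ \<beta>))) + (\<tau> * (\<sigma> - 1/4)) *\<^sub>R B \<alpha> (d $ \<alpha>))
        + (1/(2*\<tau>)) *\<^sub>R B \<alpha> (inv A (\<Sum>\<beta>\<in>UNIV. B \<beta> (e $ \<beta>))) + B \<alpha> (m $ \<alpha>)" for d e m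
      by (simp add: R_op_def op_nth)
    show ?thesis
      unfolding expand sums by (simp add: a_def b_def c_def)
  qed
  \<comment> \<open>The contributions of C combine as -(t - s)/2 + (t + s)/2 = s: the share -C/2
    inside R turns the symmetric term in w + z into the explicit sum over old increments.\<close>
  also have "\<dots> = (\<theta> / \<tau>) *\<^sub>R B \<alpha> (inv A (B \<alpha> ((w - z) $ \<alpha>))) + (1 / \<tau>) *\<^sub>R B \<alpha> (inv A s)
      + B \<alpha> ((\<sigma> - 1/4) *\<^sub>R (w - z) $ \<alpha> + (1/4) *\<^sub>R (a $ \<alpha> + 2 *\<^sub>R b $ \<alpha> + c $ \<alpha>))"
  proof -
    have collect: "(1/\<tau>) *\<^sub>R (\<theta> *\<^sub>R g - (1/2) *\<^sub>R (q - p) + (\<tau> * (\<sigma> - 1/4)) *\<^sub>R d)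
          + (1/(2*\<tau>)) *\<^sub>R (q + p) + e
        = (\<theta> / \<tau>) *\<^sub>R g + (1 / \<tau>) *\<^sub>R p + ((\<sigma> - 1/4) *\<^sub>R d + e)" for g p q d e :: 'h
      \<comment> \<open>Pairing with an arbitrary vector reduces the identity to real
        arithmetic.\<close>
      by (rule vector_eq_ldot[THEN iffD1, OF allI])
        (simp add: inner_add_right inner_diff_right \<open>\<tau> \<noteq> 0\<close> field_simps)
    show ?thesis
      unfolding lin by (rule collect)
  qed
  \<comment> \<open>As w - z = a - 2b + c, the \<sigma>-weighted mean is its value at \<sigma> = 1/4
    plus \<sigma> - 1/4 times this second difference. This is the origin of the D-term in R.\<close>
  also have "(\<sigma> - 1/4) *\<^sub>R (w - z) $ \<alpha> + (1/4) *\<^sub>R (a $ \<alpha> + 2 *\<^sub>R b $ \<alpha> + c $ \<alpha>)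
      = \<sigma> *\<^sub>R a $ \<alpha> + (1 - 2 * \<sigma>) *\<^sub>R b $ \<alpha> + \<sigma> *\<^sub>R c $ \<alpha>"
    unfolding wz vector_minus_component
    by (rule vector_eq_ldot[THEN iffD1, OF allI])
      (simp add: inner_add_right inner_diff_right algebra_simps)
  finally show "?L $ \<alpha> = (\<chi> \<alpha>. B \<alpha> (inv A (\<phi> n))) $ \<alpha>"
    by (simp add: rhs)
qed

lemma scheme_energy_le:
  assumes "inj A" "\<tau> > 0" "additive_vector_scheme A B \<theta> \<sigma> \<tau> \<phi> y" "n \<ge> 1"
  shows "scheme_energy A B \<theta> \<sigma> \<tau> y (n + 1)
    \<le> scheme_energy A B \<theta> \<sigma> \<tau> y n + \<tau> / 2 * (inv A (\<phi> n) \<bullet> \<phi> n)"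
proof -
  define w where "w = y (n + 1) - y n"
  define z where "z = y n - y (n - 1)"
  define v where "v = (y n + y (n - 1)) /\<^sub>R 2"
  define v' where "v' = (y (n + 1) + y n) /\<^sub>R 2"
  define s where "s = (\<Sum>\<alpha>\<in>UNIV. B \<alpha> ((w + z) $ \<alpha>))"
  let ?R = "R_op A B \<theta> \<sigma> \<tau>"
  have mid: "(1/4) *\<^sub>R (y (n + 1) + 2 *\<^sub>R y n + y (n - 1)) = (1/2) *\<^sub>R (v' + v)"
    unfolding v_def v'_def
    by (rule vector_eq_ldot[THEN iffD1, OF allI])
      (simp add: inner_add_right inner_diff_right field_simps)
  have incr: "w + z = 2 *\<^sub>R (v' - v)"
    unfolding v_def v'_def w_def z_def
    by (rule vector_eq_ldot[THEN iffD1, OF allI])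
      (simp add: inner_add_right inner_diff_right field_simps)
  have "(1/\<tau>) * (?R (w - z) \<bullet> (w + z)) + (1/(2*\<tau>)) * (C_op A B (w + z) \<bullet> (w + z))
      + D_op B ((1/2) *\<^sub>R (v' + v)) \<bullet> (w + z) = (\<chi> \<alpha>. B \<alpha> (inv A (\<phi> n))) \<bullet> (w + z)"
    using arg_cong[OF scheme_canonical_form[OF assms(1) _ assms(3,4), folded w_def z_def,
        unfolded mid], of "\<lambda>x. x \<bullet> (w + z)"] \<open>\<tau> > 0\<close>
    by (simp only: inner_add_left inner_scaleR_left less_irrefl not_False_eq_True)
  moreover have "?R (w - z) \<bullet> (w + z) = ?R w \<bullet> w - ?R z \<bullet> z"
  proof -
    \<comment> \<open>Symmetry of R cancels the mixed terms; the same happens for D below.\<close>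
    have "?R z \<bullet> w = ?R w \<bullet> z"
      by (metis R_op_sym inner_commute)
    then show ?thesis
      by (simp add: linear_diff[OF linear_R_op] inner_diff_left inner_add_right)
  qed
  moreover have "C_op A B (w + z) \<bullet> (w + z) = inv A s \<bullet> s"
    by (simp only: C_op_inner s_def)
  moreover have "D_op B ((1/2) *\<^sub>R (v' + v)) \<bullet> (w + z) = D_op B v' \<bullet> v' - D_op B v \<bullet> v"
  proof -
    have "D_op B v' \<bullet> v = D_op B v \<bullet> v'"
      by (metis D_op_sym inner_commute)
    then show ?thesis
      unfolding incr
      by (simp add: linear_add[OF linear_D_op] linear_scale[OF linear_D_op] inner_add_left
          inner_diff_right field_simps)
  qed
  moreover have "(\<chi> \<alpha>. B \<alpha> (inv A (\<phi> n))) \<bullet> (w + z) = inv A (\<phi> n) \<bullet> s"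
    by (simp add: inner_vec_def s_def inner_sum_right B_sym)
  moreover have "inv A (\<phi> n) \<bullet> s \<le> (1/(2*\<tau>)) * (inv A s \<bullet> s) + \<tau> / 2 * (inv A (\<phi> n) \<bullet> \<phi> n)"
  proof -
    \<comment> \<open>Scaling \<phi> by \<tau> is the choice of weight for which, after division by
      2 \<tau>, the form in \<open>s\<close> equals the C-term exactly and cancels.\<close>
    have "2 * (inv A (\<tau> *\<^sub>R \<phi> n) \<bullet> s) \<le> inv A (\<tau> *\<^sub>R \<phi> n) \<bullet> (\<tau> *\<^sub>R \<phi> n) + inv A s \<bullet> s"
      by (rule psd_inner_le) (rule lin_inv inv_sym inv_nonneg)+
    then show ?thesis
      using \<open>\<tau> > 0\<close> by (simp add: linear_scale[OF lin_inv] field_simps)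
  qed
  ultimately have "D_op B v' \<bullet> v' + (1/\<tau>) * (?R w \<bullet> w)
      \<le> D_op B v \<bullet> v + (1/\<tau>) * (?R z \<bullet> z) + \<tau> / 2 * (inv A (\<phi> n) \<bullet> \<phi> n)"
    by (simp add: right_diff_distrib)
  moreover have "(D_norm B u)\<^sup>2 = D_op B u \<bullet> u" for u
    by (simp add: D_norm_def D_op_nonneg)
  ultimately show ?thesis
    \<comment> \<open>The rule \<open>add_diff_cancel_right'\<close> turns the index
      \<open>n + 1 - 1\<close> in the new energy into \<open>n\<close>.\<close>
    unfolding scheme_energy_def add_diff_cancel_right' w_def z_def v_def v'_def by (simp only:)
qed

end

theorem theorem3p2:
  fixes A :: "'h::real_inner \<Rightarrow> 'h"
    and B :: "'p::finite \<Rightarrow> 'h \<Rightarrow> 'h"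
    and \<theta> \<sigma> :: real
  assumes fin_dim: "\<exists>S :: 'h set. finite S \<and> span S = UNIV"
    and A_pos: "op_pos A"
    and B_pos: "\<And>\<alpha>. op_pos (B \<alpha>)"
    and sigma: "\<sigma> \<ge> 1/4"
    and theta: "\<theta> \<ge> real CARD('p) / 2"
  shows "\<forall>\<tau>>0. op_nonneg (R_op A B \<theta> \<sigma> \<tau>) \<and>
           (\<forall>\<phi> y. additive_vector_scheme A B \<theta> \<sigma> \<tau> \<phi> y \<longrightarrow>
              (\<forall>n\<ge>1. scheme_energy A B \<theta> \<sigma> \<tau> y (n + 1)
                        \<le> scheme_energy A B \<theta> \<sigma> \<tau> y n + \<tau> / 2 * (inv A (\<phi> n) \<bullet> \<phi> n)))"
proof -
  have inv_pos: "op_pos (inv A)"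
    using fin_dim A_pos by (rule op_pos_inv)
  have nonneg: "S x \<bullet> x \<ge> 0" if "op_pos S" for S :: "'h \<Rightarrow> 'h" and x
    using that by (cases "x = 0") (auto simp: op_pos_def less_imp_le)
  \<comment> \<open>Finite dimension is used here to convert \<open>adjoint S = S\<close> into
    symmetry of the inner products.\<close>
  interpret scheme_operators A B
  proof (rule scheme_operators.intro)
    show "linear (inv A)"
      using inv_pos by (simp add: op_pos_def self_adjoint_def)
    show "linear (B \<alpha>)" for \<alpha>
      using B_pos by (simp add: op_pos_def self_adjoint_def)
    show "inv A x \<bullet> y = x \<bullet> inv A y" for x y
      using inv_pos by (simp add: op_pos_def self_adjoint_inner[OF fin_dim])
    show "B \<alpha> x \<bullet> y = x \<bullet> B \<alpha> y" for \<alpha> x y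
      using B_pos by (simp add: op_pos_def self_adjoint_inner[OF fin_dim])
  qed (rule nonneg inv_pos B_pos)+
  have "inj A"
    using op_pos_bij[OF fin_dim A_pos] by (rule bij_is_inj)
  then show ?thesis
    using R_op_nonneg[OF theta sigma] scheme_energy_le by blast
qed

end
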